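(* Let $k$ be a positive real number, and let $r_1>r_2$ be the roots of the equation $x^{2}-(k+2)x+k=0$. Then for every integer $n\ge 0$ the binomial transform $(b_{k,n})_{n\ge 0}$ of the modified $k$-Fibonacci-like sequence is given by $$b_{k,n}= 4\,\frac{r_{1}^{n}-r_{2}^{n}}{r_{1}-r_{2}}- 2k\,\frac{r_{1}^{n-1}-r_{2}^{n-1}}{r_{1}-r_{2}}.$$
   Context: For a positive real number $k$, the modified $k$-Fibonacci-like sequence $(M_{k,n})_{n\ge 0}$ is defined by $M_{k,0}=M_{k,1}=2$ and $M_{k,n+1}=kM_{k,n}+M_{k,n-1}$ for $n\ge 1$. Its binomial transform $(b_{k,n})_{n\ge 0}$ is defined by $b_{k,n}=\sum_{i=0}^{n}\binom{n}{i}M_{k,i}$. Exponents are integer exponents (for $n=0$ the exponent $n-1$ equals $-1$). *)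

theory Defs
  imports Complex_Main
begin

fun mod_fib_like :: "real \<Rightarrow> nat \<Rightarrow> real" where
  "mod_fib_like k 0 = 2"
| "mod_fib_like k (Suc 0) = 2"
| "mod_fib_like k (Suc (Suc n)) = k * mod_fib_like k (Suc n) + mod_fib_like k n"

definition binomial_transform :: "(nat \<Rightarrow> real) \<Rightarrow> nat \<Rightarrow> real" where
  "binomial_transform a n = (\<Sum>i=0..n. of_nat (n choose i) * a i)"

end

theory Submission
  imports Defs
begin

text \<open>
  Let \<open>E\<close> be the shift operator on sequences. Pascal's rule says that passing from \<open>n\<close> to
  \<open>n + 1\<close> in the binomial transform of \<open>a\<close> amounts to transforming \<open>(1 + E) a\<close> instead of \<open>a\<close>
  (\<open>binomial_transform_Suc\<close>). The Fibonacci-like recurrence is \<open>E\<^sup>2 = k E + 1\<close>, and hence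
  \<open>(1 + E)\<^sup>2 = (k + 2) (1 + E) - k\<close>. So the transform satisfies the linear recurrence whose
  characteristic polynomial is \<open>x\<^sup>2 - (k + 2) x + k\<close>
  (\<open>binomial_transform_mod_fib_like_rec\<close>).

  The powers of \<open>r\<^sub>1\<close> and \<open>r\<^sub>2\<close>, also with exponents shifted by \<open>-1\<close>, solve the same recurrence,
  so it suffices to compare the initial values. They are \<open>2\<close> and \<open>4\<close> on both sides; the value
  at \<open>0\<close> uses \<open>r\<^sub>1 r\<^sub>2 = k\<close>.
\<close>

lemma binomial_transform_Suc:
  "binomial_transform a (Suc n) =
    binomial_transform a n + binomial_transform (\<lambda>i. a (Suc i)) n"
proof -
  have "binomial_transform a (Suc n) =
      a 0 + (\<Sum>i=0..n. of_nat (Suc n choose Suc i) * a (Suc i))"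
    unfolding binomial_transform_def
    by (subst sum.atLeast0_atMost_Suc_shift) simp
  also have "\<dots> = (a 0 + (\<Sum>i=0..n. of_nat (n choose Suc i) * a (Suc i)))
      + binomial_transform (\<lambda>i. a (Suc i)) n"
    by (simp add: binomial_transform_def sum.distrib algebra_simps)
  \<comment> \<open>The added top summand contains \<open>n choose Suc n = 0\<close>.\<close>
  also have "a 0 + (\<Sum>i=0..n. of_nat (n choose Suc i) * a (Suc i)) =
      (\<Sum>i=0..Suc n. of_nat (n choose i) * a i)"
    by (subst sum.atLeast0_atMost_Suc_shift) simp
  also have "\<dots> = binomial_transform a n"
    by (simp add: binomial_transform_def)
  finally show ?thesis .
qed

lemma binomial_transform_lincomb:
  "binomial_transform (\<lambda>i. c * a i + b i) n =
    c * binomial_transform a n + binomial_transform b n"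
  by (simp add: binomial_transform_def sum.distrib sum_distrib_left algebra_simps)

lemma binomial_transform_mod_fib_like_rec:
  "binomial_transform (mod_fib_like k) (Suc (Suc n)) =
    (k + 2) * binomial_transform (mod_fib_like k) (Suc n)
    - k * binomial_transform (mod_fib_like k) n"
  by (simp add: binomial_transform_Suc binomial_transform_lincomb) (simp add: algebra_simps)

lemma linear_recurrence2_unique:
  fixes f g :: "nat \<Rightarrow> 'a::comm_ring_1"
  assumes "\<And>n. f (Suc (Suc n)) = p * f (Suc n) - q * f n"
    and "\<And>n. g (Suc (Suc n)) = p * g (Suc n) - q * g n"
    and "f 0 = g 0" and "f (Suc 0) = g (Suc 0)"
  shows "f n = g n"
  by (induction n rule: induct_nat_012) (simp_all add: assms)

theorem theorem5:
  fixes k r1 r2 :: real and n :: nat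
  assumes "k > 0"
    and "r1\<^sup>2 - (k + 2) * r1 + k = 0"
    and "r2\<^sup>2 - (k + 2) * r2 + k = 0"
    and "r1 > r2"
  shows "binomial_transform (mod_fib_like k) n =
    4 * ((r1 ^ n - r2 ^ n) / (r1 - r2))
    - 2 * k * ((r1 powi (int n - 1) - r2 powi (int n - 1)) / (r1 - r2))"
proof -
  have nz: "r1 \<noteq> 0" "r2 \<noteq> 0"
    using assms by auto
  have "(r1 - r2) * (r1 + r2 - (k + 2)) = 0"
    using assms(2,3) by (simp add: algebra_simps power2_eq_square)
  then have "r1 + r2 = k + 2"
    using assms(4) by simp
  then have prod: "r1 * r2 = k"
    using assms(2) by (simp add: algebra_simps power2_eq_square flip: \<open>r1 + r2 = k + 2\<close>)
  define g where "g n =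
    4 * ((r1 ^ n - r2 ^ n) / (r1 - r2))
    - 2 * k * ((r1 ^ n / r1 - r2 ^ n / r2) / (r1 - r2))" for n
  \<comment> \<open>Collecting the powers of each root makes the recurrence evident.\<close>
  define c1 c2 where "c1 = (4 - 2 * k / r1) / (r1 - r2)" and "c2 = (4 - 2 * k / r2) / (r1 - r2)"
  have g: "g n = c1 * r1 ^ n - c2 * r2 ^ n" for n
    using assms(4) nz by (simp add: g_def c1_def c2_def field_simps)
  have pow_rec: "r ^ Suc (Suc n) = (k + 2) * r ^ Suc n - k * r ^ n"
    if "r\<^sup>2 - (k + 2) * r + k = 0" for r :: real and n
  proof -
    have "r\<^sup>2 = (k + 2) * r - k"
      using that by simp
    then have "r ^ n * r\<^sup>2 = r ^ n * ((k + 2) * r - k)"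
      by simp
    then show ?thesis
      by (simp add: algebra_simps power2_eq_square)
  qed
  have g_rec: "g (Suc (Suc n)) = (k + 2) * g (Suc n) - k * g n" for n
    unfolding g pow_rec[OF assms(2)] pow_rec[OF assms(3)] by (simp add: algebra_simps)
  have g0: "g 0 = 2"
    using assms(4) nz by (simp add: g_def field_simps flip: prod)
  have g1: "g (Suc 0) = 4"
    using assms(4) nz by (simp add: g_def)
  have "binomial_transform (mod_fib_like k) n = g n"
    by (rule linear_recurrence2_unique
        [where f = "binomial_transform (mod_fib_like k)" and g = g,
          OF binomial_transform_mod_fib_like_rec g_rec])
      (simp_all add: binomial_transform_def g0 g1)
  moreover have "r powi (int n - 1) = r ^ n / r" if "r \<noteq> 0" for r :: real
    using that by (simp add: power_int_diff)
  ultimately show ?thesis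
    using nz by (simp add: g_def)
qed

end
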